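(* Every deer graph is super edge-magic.
   Context: Graphs are finite and undirected, may contain loops, but multiple edges are not allowed. For integers $m\le n$, $[m,n]=\{m,m+1,\dots,n\}$. A caterpillar is a tree for which the deletion of all vertices of degree $1$ leaves a path, called its spine. A deer graph is a graph obtained as follows: take a caterpillar whose spine is a path $u_1u_2\cdots u_{2t+1}$ with an odd number of vertices (drawn on a horizontal line) such that the sequence of degrees (in the caterpillar) of the spine vertices reads the same from left to right as from right to left, i.e. $\deg(u_i)=\deg(u_{2t+2-i})$ for all $i\in[1,2t+1]$; then attach a loop at the central vertex $u_{t+1}$ of the spine. Let $G$ be a graph with $p$ vertices and $q$ edges (loops count as edges). $G$ is edge-magic if there is a bijection $f:V(G)\cup E(G)\to[1,p+q]$ and a constant $k$ such that $f(x)+f(xy)+f(y)=k$ for every edge $xy\in E(G)$ (for a loop, $x=y$). $G$ is super edge-magic if there is such an $f$ with, in addition, $f(V(G))=[1,p]$. It is known that, equivalently, $G$ is super edge-magic if and only if there is a bijection $g:V(G)\to[1,p]$ such that $\{g(u)+g(v):uv\in E(G)\}$ is a set of $q$ consecutive integers (a loop at $u$ contributes $2g(u)$). *)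

theory Defs
  imports Main
begin

text \<open>
  Undirected graphs with loops but without multiple edges: the edge joining \<open>x\<close> and \<open>y\<close> is the
  set \<open>{x, y}\<close>, so a loop at \<open>x\<close> is the singleton \<open>{x}\<close>.
\<close>

record 'a ugraph =
  verts :: "'a set"
  edges :: "'a set set"

definition fin_ugraph :: "'a ugraph \<Rightarrow> bool" where
  "fin_ugraph G \<longleftrightarrow> finite (verts G) \<and>
     (\<forall>e\<in>edges G. \<exists>x\<in>verts G. \<exists>y\<in>verts G. e = {x, y})"

text \<open>A loop contributes two to the degree.\<close>

definition deg :: "'a ugraph \<Rightarrow> 'a \<Rightarrow> nat" where
  "deg G v = card {e \<in> edges G. v \<in> e} + card {e \<in> edges G. e = {v}}"

definition induced_subgraph :: "'a ugraph \<Rightarrow> 'a set \<Rightarrow> 'a ugraph" where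
  "induced_subgraph G W = \<lparr>verts = verts G \<inter> W, edges = {e \<in> edges G. e \<subseteq> W}\<rparr>"

definition connected_ugraph :: "'a ugraph \<Rightarrow> bool" where
  "connected_ugraph G \<longleftrightarrow> verts G \<noteq> {} \<and>
     (\<forall>x\<in>verts G. \<forall>y\<in>verts G. (x, y) \<in> {(a, b). {a, b} \<in> edges G}\<^sup>*)"

text \<open>
  A cycle is given by the cyclic list of its vertices. Length 1 is a loop; length 2 is excluded,
  since it would traverse a single edge back and forth.
\<close>

definition is_cycle :: "'a ugraph \<Rightarrow> 'a list \<Rightarrow> bool" where
  "is_cycle G xs \<longleftrightarrow> length xs \<ge> 1 \<and> length xs \<noteq> 2 \<and> distinct xs \<and> set xs \<subseteq> verts G \<and>
     (\<forall>i<length xs. {xs ! i, xs ! (Suc i mod length xs)} \<in> edges G)"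

definition is_tree :: "'a ugraph \<Rightarrow> bool" where
  "is_tree G \<longleftrightarrow> fin_ugraph G \<and> connected_ugraph G \<and> (\<nexists>xs. is_cycle G xs)"

definition is_path_graph :: "'a ugraph \<Rightarrow> 'a list \<Rightarrow> bool" where
  "is_path_graph G us \<longleftrightarrow> distinct us \<and> verts G = set us \<and>
     edges G = {{us ! i, us ! Suc i} | i. Suc i < length us}"

definition caterpillar_spine :: "'a ugraph \<Rightarrow> 'a list \<Rightarrow> bool" where
  "caterpillar_spine G us \<longleftrightarrow> is_tree G \<and>
     is_path_graph (induced_subgraph G {v \<in> verts G. deg G v \<noteq> 1}) us"

definition add_loop :: "'a ugraph \<Rightarrow> 'a \<Rightarrow> 'a ugraph" where
  "add_loop G v = \<lparr>verts = verts G, edges = insert {v} (edges G)\<rparr>"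

text \<open>
  Lists are indexed from 0: the spine vertex \<open>u\<^sub>i\<close> of the usual numbering \<open>u\<^sub>1, \<dots>, u\<^sub>2\<^sub>t\<^sub>+\<^sub>1\<close> is
  \<open>us ! (i - 1)\<close>, so its mirror image is \<open>us ! (2 * t + 1 - i)\<close> and the central vertex is \<open>us ! t\<close>.
\<close>

definition deer_graph :: "'a ugraph \<Rightarrow> bool" where
  "deer_graph G \<longleftrightarrow> (\<exists>C us t. caterpillar_spine C us \<and> length us = 2 * t + 1 \<and>
     (\<forall>i\<in>{1..2 * t + 1}. deg C (us ! (i - 1)) = deg C (us ! (2 * t + 1 - i))) \<and>
     G = add_loop C (us ! t))"

definition edge_magic_labeling :: "'a ugraph \<Rightarrow> ('a + 'a set \<Rightarrow> nat) \<Rightarrow> nat \<Rightarrow> bool" where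
  "edge_magic_labeling G f k \<longleftrightarrow>
     bij_betw f (verts G <+> edges G) {1..card (verts G) + card (edges G)} \<and>
     (\<forall>x y. {x, y} \<in> edges G \<longrightarrow> f (Inl x) + f (Inr {x, y}) + f (Inl y) = k)"

definition edge_magic :: "'a ugraph \<Rightarrow> bool" where
  "edge_magic G \<longleftrightarrow> (\<exists>f k. edge_magic_labeling G f k)"

definition super_edge_magic :: "'a ugraph \<Rightarrow> bool" where
  "super_edge_magic G \<longleftrightarrow> (\<exists>f k. edge_magic_labeling G f k \<and>
     f ` Inl ` verts G = {1..card (verts G)})"

end

theory Submission imports Defs "HOL-Library.Product_Lexorder"
begin

text \<open>
  List the vertices of the caterpillar as \<open>u\<^sub>0\<close>, leaves at \<open>u\<^sub>0\<close>, \<open>u\<^sub>1\<close>, leaves at \<open>u\<^sub>1\<close>, and so on,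
  and colour it properly with two colours. Every vertex \<open>v\<close> but the first then has a parent: the
  spine vertex that carries \<open>v\<close> if \<open>v\<close> is a leaf, the preceding spine vertex otherwise. The edges
  are exactly the pairs of a vertex and its parent, and the parent of \<open>v\<close> is the last vertex before
  \<open>v\<close> in the list whose colour differs from that of \<open>v\<close>.

  Let \<open>A\<close> be the colour class of the central spine vertex \<open>c\<close>. Number \<open>A\<close> in list order with
  \<open>1, \<dots>, |A|\<close> and the other class in list order with \<open>|A| + 1, \<dots>, p\<close>. On the edge
  from \<open>v\<close> to its parent, each endpoint contributes, apart from the shift by \<open>|A|\<close> in one class, the
  number of vertices of its colour up to \<open>v\<close>: for the parent this holds since no vertex of its colour
  lies strictly between it and \<open>v\<close>. The edge sum is thus \<open>|A|\<close> plus the place of \<open>v\<close> in the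
  list, and the tree edges have the sums \<open>|A| + 2, \<dots>, |A| + p\<close> (\<open>zigzag_super_edge_magic\<close>).

  The loop has to fill the value \<open>|A| + 1\<close>, which means that \<open>c\<close> is the median of \<open>A\<close>. This is
  where the symmetry enters: equal degrees of \<open>u\<^sub>i\<close> and its mirror image mean equally many leaves
  (\<open>deg_spine\<close>), reflection preserves colours because the spine has odd length, and
  the leaves at \<open>c\<close> are not in \<open>A\<close>. Hence \<open>A\<close> has as many vertices before \<open>c\<close> as after it.
  Consecutive edge sums finally give the magic labelling (\<open>super_edge_magic_if_consecutive_sums\<close>).
\<close>

section \<open>Consecutive edge sums\<close>

text \<open>
  Minimum and maximum make the sum a function of the edge as a set, and count the label of a loop
  twice.
\<close>

definition edge_sum :: "('a \<Rightarrow> nat) \<Rightarrow> 'a set \<Rightarrow> nat" where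
  "edge_sum g e = Min (g ` e) + Max (g ` e)"

lemma edge_sum_pair [simp]: "edge_sum g {x, y} = g x + g y"
  by (simp add: edge_sum_def min_def max_def)

text \<open>
  Give the edges the remaining labels in the order opposite to that of their sums: the larger the sum
  of the end labels, the smaller the label of the edge, so that the total is constant.
\<close>

lemma super_edge_magic_if_consecutive_sums:
  assumes g: "bij_betw g (verts G) {1..card (verts G)}"
    and s: "bij_betw (edge_sum g) (edges G) {s + 1..s + card (edges G)}"
  shows "super_edge_magic G"
proof -
  let ?p = "card (verts G)" and ?q = "card (edges G)"
  \<comment> \<open>The least edge sum \<open>s + 1\<close> must be complemented by the largest label \<open>?p + ?q\<close>.\<close>
  define k where "k = ?p + ?q + s + 1"
  define f where "f = case_sum g (\<lambda>e. k - edge_sum g e)"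
  have s_le: "s + 1 \<le> edge_sum g e \<and> edge_sum g e \<le> s + ?q" if "e \<in> edges G" for e
    using bij_betwE[OF s] that by auto
  have "bij_betw (\<lambda>n. k - n) {s + 1..s + ?q} {?p + 1..?p + ?q}"
    by (rule bij_betw_byWitness[where f' = "\<lambda>n. k - n"]) (auto simp: k_def)
  from bij_betw_trans[OF s this]
  have e: "bij_betw (\<lambda>e. k - edge_sum g e) (edges G) {?p + 1..?p + ?q}"
    by (simp add: comp_def)
  have "bij_betw f (Inl ` verts G \<union> Inr ` edges G) ({1..?p} \<union> {?p + 1..?p + ?q})"
  proof (rule bij_betw_combine)
    show "bij_betw f (Inl ` verts G) {1..?p}"
      using g by (auto simp: bij_betw_def f_def inj_on_def image_image)
    show "bij_betw f (Inr ` edges G) {?p + 1..?p + ?q}"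
      using e by (auto simp: bij_betw_def f_def inj_on_def image_image)
  qed auto
  moreover have "{1..?p} \<union> {?p + 1..?p + ?q} = {1..?p + ?q}"
    by auto
  ultimately have "bij_betw f (verts G <+> edges G) {1..?p + ?q}"
    by (simp add: Plus_def)
  moreover have "f (Inl x) + f (Inr {x, y}) + f (Inl y) = k" if "{x, y} \<in> edges G" for x y
    using s_le[OF that] by (simp add: f_def k_def)
  moreover have "f ` Inl ` verts G = {1..?p}"
    using g by (simp add: f_def image_image bij_betw_def)
  ultimately show ?thesis
    unfolding super_edge_magic_def edge_magic_labeling_def by blast
qed

section \<open>Labelling two-coloured sequences by rank\<close>

definition rank :: "('a \<Rightarrow> 'k::linorder) \<Rightarrow> 'a set \<Rightarrow> 'a \<Rightarrow> nat" where
  "rank key S v = card {w \<in> S. key w \<le> key v}"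

lemma bij_betw_rank:
  assumes fin: "finite S" and inj: "inj_on key S"
  shows "bij_betw (rank key S) S {1..card S}"
proof -
  have less: "rank key S v < rank key S w" if "v \<in> S" "w \<in> S" "key v < key w" for v w
    unfolding rank_def
  proof (rule psubset_card_mono)
    have "w \<in> {x \<in> S. key x \<le> key w} - {x \<in> S. key x \<le> key v}"
      using that by auto
    then show "{x \<in> S. key x \<le> key v} \<subset> {x \<in> S. key x \<le> key w}"
      using that by auto
  qed (use fin in simp)
  have "inj_on (rank key S) S"
  proof (rule inj_onI)
    fix v w assume vw: "v \<in> S" "w \<in> S" "rank key S v = rank key S w"
    then have "key v = key w"
      using less[of v w] less[of w v] by (metis less_irrefl linorder_less_linear)
    with inj vw show "v = w" by (auto dest: inj_onD)
  qed
  moreover have "rank key S ` S \<subseteq> {1..card S}"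
  proof
    fix n assume "n \<in> rank key S ` S"
    then obtain v where v: "v \<in> S" "n = rank key S v" by blast
    have "card {v} \<le> n" "n \<le> card S"
      unfolding v(2) rank_def using v(1) fin by (intro card_mono; auto)+
    then show "n \<in> {1..card S}" by simp
  qed
  ultimately show ?thesis
    by (simp add: bij_betw_def card_image card_subset_eq)
qed

text \<open>
  A sequence of vertices in two colours, ordered by \<open>key\<close>, determines a caterpillar: join each vertex
  to the last earlier one of the other colour. With the labelling by ranks within the colour classes,
  the edge at \<open>v\<close> has sum \<open>card A + rank key V v\<close>, because \<open>rank\<close> in the other class does not change
  from the parent to \<open>v\<close>. Only the value belonging to the first vertex \<open>r\<close> is left over, and a
  loop at the median of \<open>A\<close> takes it.
\<close>

lemma zigzag_super_edge_magic:
  fixes key :: "'a \<Rightarrow> 'k::linorder"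
  assumes fin: "finite V" and inj: "inj_on key V" and A: "A \<subseteq> V"
    and r: "r \<in> V" "\<And>v. v \<in> V \<Longrightarrow> key r \<le> key v"
    and par_in: "\<And>v. v \<in> V \<Longrightarrow> v \<noteq> r \<Longrightarrow> par v \<in> V"
    and par_less: "\<And>v. v \<in> V \<Longrightarrow> v \<noteq> r \<Longrightarrow> key (par v) < key v"
    and par_colour: "\<And>v. v \<in> V \<Longrightarrow> v \<noteq> r \<Longrightarrow> par v \<in> A \<longleftrightarrow> v \<notin> A"
    and par_last: "\<And>v w. \<lbrakk>v \<in> V; v \<noteq> r; w \<in> V; key w < key v; w \<in> A \<longleftrightarrow> v \<notin> A\<rbrakk>
      \<Longrightarrow> key w \<le> key (par v)"
    and c: "c \<in> A"
    and median: "card {v \<in> A. key v < key c} = card {v \<in> A. key c < key v}"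
  shows "super_edge_magic \<lparr>verts = V, edges = insert {c} ((\<lambda>v. {v, par v}) ` (V - {r}))\<rparr>"
    (is "super_edge_magic ?G")
proof (rule super_edge_magic_if_consecutive_sums)
  define g where "g v = (if v \<in> A then rank key A v else card A + rank key (V - A) v)" for v
  \<comment> \<open>Charging the loop to the first vertex indexes the edges by the vertices.\<close>
  define edge where "edge v = (if v = r then {c} else {v, par v})" for v
  have finA: "finite A" and cV: "c \<in> V"
    using A c fin finite_subset by auto
  have cardV: "card V = card A + card (V - A)"
    using A fin by (metis card_Un_disjnt Diff_partition disjnt_def Diff_disjoint finA finite_Diff)

  have bij_shift: "bij_betw ((+) (card A)) {1..card (V - A)} {card A + 1..card V}"
    unfolding cardV by (rule bij_betw_byWitness[where f' = "\<lambda>n. n - card A"]) auto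
  have "bij_betw g (A \<union> (V - A)) ({1..card A} \<union> {card A + 1..card V})"
  proof (rule bij_betw_combine)
    have "bij_betw (rank key A) A {1..card A}"
      using bij_betw_rank[OF finA inj_on_subset[OF inj A]] .
    then show "bij_betw g A {1..card A}"
      by (rule bij_betw_cong[THEN iffD1, rotated]) (simp add: g_def)
    have "bij_betw (rank key (V - A)) (V - A) {1..card (V - A)}"
      using fin inj by (intro bij_betw_rank) (auto intro: inj_on_subset)
    from bij_betw_trans[OF this bij_shift]
    show "bij_betw g (V - A) {card A + 1..card V}"
      by (rule bij_betw_cong[THEN iffD1, rotated]) (simp add: g_def)
  qed auto
  moreover have "A \<union> (V - A) = V" "{1..card A} \<union> {card A + 1..card V} = {1..card V}"
    using A cardV by auto
  ultimately show "bij_betw g (verts ?G) {1..card (verts ?G)}"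
    by simp

  have sum_par: "g v + g (par v) = card A + rank key V v" if v: "v \<in> V" "v \<noteq> r" for v
  proof -
    note pv = par_in[OF v] par_less[OF v] par_colour[OF v]
    have split: "rank key V v = rank key A v + rank key (V - A) v"
    proof -
      have "{w \<in> V. key w \<le> key v} = {w \<in> A. key w \<le> key v} \<union> {w \<in> V - A. key w \<le> key v}"
        using A by auto
      then show ?thesis
        unfolding rank_def using fin finA by (simp add: card_Un_disjnt disjnt_def Int_def)
    qed
    \<comment> \<open>Between the parent and \<open>v\<close> only vertices of the colour of \<open>v\<close> occur.\<close>
    have below: "key w \<le> key (par v) \<longleftrightarrow> key w \<le> key v"
      if w: "w \<in> V" "w \<in> A \<longleftrightarrow> v \<notin> A" for w
    proof
      assume "key w \<le> key v"
      moreover have "key w \<noteq> key v"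
        using w v inj by (auto dest: inj_onD)
      ultimately show "key w \<le> key (par v)"
        using par_last[OF v w(1) _ w(2)] by simp
    qed (use pv in auto)
    show ?thesis
    proof (cases "v \<in> A")
      case True
      have "rank key (V - A) (par v) = rank key (V - A) v"
        unfolding rank_def using True below by (intro arg_cong[where f = card]) auto
      with True pv split show ?thesis by (simp add: g_def)
    next
      case False
      have "rank key A (par v) = rank key A v"
        unfolding rank_def using False below A by (intro arg_cong[where f = card]) auto
      with False pv split show ?thesis by (simp add: g_def)
    qed
  qed

  have sum_loop: "2 * g c = card A + 1"
  proof -
    have eq: "{w \<in> A. key w \<le> key c} = insert c {w \<in> A. key w < key c}"
      using c A cV inj by (auto simp: le_less dest: inj_onD)
    then have 1: "rank key A c = Suc (card {w \<in> A. key w < key c})"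
      using finA by (simp add: rank_def)
    have "A = {w \<in> A. key w \<le> key c} \<union> {w \<in> A. key c < key w}"
      by auto
    then have "card A = card ({w \<in> A. key w \<le> key c} \<union> {w \<in> A. key c < key w})"
      by simp
    also have "\<dots> = rank key A c + card {w \<in> A. key c < key w}"
      unfolding rank_def using finA by (intro card_Un_disjoint) auto
    finally show ?thesis
      using 1 median c by (simp add: g_def)
  qed
  have rank_r: "rank key V r = 1"
  proof -
    have "{w \<in> V. key w \<le> key r} = {r}"
      using r inj by (auto intro: inj_onD antisym)
    then show ?thesis by (simp add: rank_def)
  qed
  have sum_edge: "edge_sum g (edge v) = card A + rank key V v" if "v \<in> V" for v
    using sum_par[of v] sum_loop rank_r that edge_sum_pair[of g c c] by (auto simp: edge_def)

  have edges: "edges ?G = edge ` V"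
    using r(1) by (auto simp: edge_def image_iff)
  have "bij_betw ((+) (card A)) {1..card V} {card A + 1..card A + card V}"
    by (rule bij_betw_byWitness[where f' = "\<lambda>n. n - card A"]) auto
  from bij_betw_trans[OF bij_betw_rank[OF fin inj] this]
  have "bij_betw (edge_sum g \<circ> edge) V {card A + 1..card A + card V}"
    by (rule bij_betw_cong[THEN iffD1, rotated]) (simp add: sum_edge)
  then have inj_sum: "inj_on (edge_sum g \<circ> edge) V"
    and img_sum: "(edge_sum g \<circ> edge) ` V = {card A + 1..card A + card V}"
    by (auto simp: bij_betw_def)
  have "card (edges ?G) = card V"
    unfolding edges using inj_sum by (simp add: card_image inj_on_imageI2)
  with inj_sum img_sum edges
  show "bij_betw (edge_sum g) (edges ?G) {card A + 1..card A + card (edges ?G)}"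
    by (simp add: bij_betw_def inj_on_imageI image_comp)
qed

section \<open>Caterpillars\<close>

text \<open>
  The position of a vertex is the index of the spine vertex that it is or is attached to. The spine
  describes only the edges between spine vertices; the other edges are found from the vertices of
  degree one, each of which has a single neighbour, on the spine by connectedness.
\<close>

lemma caterpillar_positions:
  assumes cat: "caterpillar_spine C us" and ne: "us \<noteq> []"
  obtains pos where
    "\<And>i. i < length us \<Longrightarrow> pos (us ! i) = i"
    "\<And>v. v \<in> verts C \<Longrightarrow> pos v < length us"
    "edges C = (\<lambda>i. {us ! i, us ! Suc i}) ` {i. Suc i < length us} \<union>
       (\<lambda>v. {v, us ! pos v}) ` (verts C - set us)"
proof -
  let ?V = "verts C" and ?E = "edges C"
  have fin: "finite ?V" and ends: "\<And>e. e \<in> ?E \<Longrightarrow> \<exists>x\<in>?V. \<exists>y\<in>?V. e = {x, y}"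
    and conn: "\<And>x y. x \<in> ?V \<Longrightarrow> y \<in> ?V \<Longrightarrow> (x, y) \<in> {(a, b). {a, b} \<in> ?E}\<^sup>*"
    and acyc: "\<nexists>xs. is_cycle C xs"
    using cat by (auto simp: caterpillar_spine_def is_tree_def fin_ugraph_def connected_ugraph_def)
  have dist: "distinct us" and set_us: "set us = {v \<in> ?V. deg C v \<noteq> 1}"
    and induced:
      "{e \<in> ?E. e \<subseteq> {v \<in> ?V. deg C v \<noteq> 1}} = {{us ! i, us ! Suc i} |i. Suc i < length us}"
    using cat Int_absorb1[of "{v \<in> ?V. deg C v \<noteq> 1}" ?V]
    unfolding caterpillar_spine_def is_path_graph_def induced_subgraph_def by auto
  note spine = induced[folded set_us]
  have no_loop: "{x} \<notin> ?E" for x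
  proof
    assume "{x} \<in> ?E"
    then have "is_cycle C [x]"
      using ends[of "{x}"] by (auto simp: is_cycle_def)
    with acyc show False by blast
  qed
  have card_inc: "card {e \<in> ?E. v \<in> e} = 1" if v: "v \<in> ?V" "v \<notin> set us" for v
  proof -
    have "deg C v = 1" using v set_us by auto
    moreover have "{e \<in> ?E. e = {v}} = {}" using no_loop by auto
    ultimately show ?thesis by (simp add: deg_def)
  qed
  \<comment> \<open>Two adjacent vertices of degree one would form a whole component, and the nonempty spine
    lies outside it.\<close>
  have leaf: "\<exists>w. w \<in> set us \<and> {e \<in> ?E. v \<in> e} = {{v, w}}" if v: "v \<in> ?V" "v \<notin> set us" for v
  proof -
    from card_inc[OF v] obtain e where e: "{e \<in> ?E. v \<in> e} = {e}" by (auto simp: card_1_singleton_iff)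
    then have "e \<in> ?E" "v \<in> e" by blast+
    with ends[of e] obtain w where w: "w \<in> ?V" "e = {v, w}" by auto
    have "w \<in> set us"
    proof (rule ccontr)
      assume "w \<notin> set us"
      with w have "card {e \<in> ?E. w \<in> e} = 1" by (intro card_inc)
      moreover have "e \<in> {e \<in> ?E. w \<in> e}" using \<open>e \<in> ?E\<close> w by auto
      ultimately have ew: "{e \<in> ?E. w \<in> e} = {e}" by (metis card_1_singletonE singletonD)
      have "y \<in> {v, w}" if "(x, y) \<in> {(a, b). {a, b} \<in> ?E}\<^sup>*" "x \<in> {v, w}" for x y
        using that
      proof (induction rule: rtrancl_induct)
        case (step y z)
        then have "{y, z} \<in> ?E" "y = v \<or> y = w" by auto
        then have "{y, z} \<in> {e \<in> ?E. v \<in> e} \<union> {e \<in> ?E. w \<in> e}" by auto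
        then have "{y, z} = {v, w}" unfolding e ew using w by simp
        then show ?case by auto
      qed simp
      from this[OF conn[of v "hd us"]] v have "hd us \<in> {v, w}"
        using ne set_us hd_in_set[OF ne] by auto
      then show False
        using hd_in_set[OF ne] v(2) \<open>w \<notin> set us\<close> by auto
    qed
    with e w show ?thesis by auto
  qed
  define pos where
    "pos v = (THE i. i < length us \<and> (if v \<in> set us then v = us ! i else {v, us ! i} \<in> ?E))" for v
  have pos_us: "pos (us ! i) = i" if "i < length us" for i
    unfolding pos_def using that dist by (intro the_equality) (auto simp: nth_eq_iff_index_eq)
  have pos_leaf: "pos v < length us \<and> {e \<in> ?E. v \<in> e} = {{v, us ! pos v}}"
    if v: "v \<in> ?V" "v \<notin> set us" for v
  proof -
    from leaf[OF v] obtain i where i: "i < length us" "{e \<in> ?E. v \<in> e} = {{v, us ! i}}"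
      by (auto simp: in_set_conv_nth)
    have "pos v = i"
      unfolding pos_def
    proof (rule the_equality)
      show "i < length us \<and> (if v \<in> set us then v = us ! i else {v, us ! i} \<in> ?E)"
        using i v by auto
      fix j assume "j < length us \<and> (if v \<in> set us then v = us ! j else {v, us ! j} \<in> ?E)"
      then have j: "j < length us" "{v, us ! j} \<in> {e \<in> ?E. v \<in> e}" using v by auto
      then have "us ! j = us ! i"
        unfolding i(2) by (auto simp: doubleton_eq_iff)
      with i j dist show "j = i" by (simp add: nth_eq_iff_index_eq)
    qed
    with i show ?thesis by simp
  qed
  have "?E = {e \<in> ?E. e \<subseteq> set us} \<union> (\<Union>v\<in>?V - set us. {e \<in> ?E. v \<in> e})"
    using ends by fastforce
  also have "(\<Union>v\<in>?V - set us. {e \<in> ?E. v \<in> e}) = (\<lambda>v. {v, us ! pos v}) ` (?V - set us)"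
    using pos_leaf by auto
  finally have E: "?E = (\<lambda>i. {us ! i, us ! Suc i}) ` {i. Suc i < length us} \<union>
      (\<lambda>v. {v, us ! pos v}) ` (?V - set us)"
    unfolding spine by (simp add: setcompr_eq_image)
  show ?thesis
  proof
    show "pos v < length us" if "v \<in> ?V" for v
      using that pos_leaf pos_us by (cases "v \<in> set us") (auto simp: in_set_conv_nth)
  qed (use pos_us E in auto)
qed

text \<open>
  The number of spine neighbours of a spine vertex depends only on whether it is an end of the
  spine, so equal degrees at mirror positions force equal numbers of leaves.
\<close>

lemma deg_spine:
  assumes dist: "distinct us" and us: "set us \<subseteq> verts C" and fin: "finite (verts C)"
    and E: "edges C = (\<lambda>i. {us ! i, us ! Suc i}) ` {i. Suc i < length us} \<union>
       (\<lambda>v. {v, us ! pos v}) ` (verts C - set us)"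
    and pos: "\<And>v. v \<in> verts C \<Longrightarrow> pos v < length us"
    and i: "i < length us"
  shows "deg C (us ! i) = card {v \<in> verts C - set us. pos v = i}
    + ((if i = 0 then 0 else 1) + (if Suc i < length us then 1 else 0))"
proof -
  let ?L = "{v \<in> verts C - set us. pos v = i}"
  \<comment> \<open>Indices \<open>j\<close> of the spine edges \<open>{us ! j, us ! Suc j}\<close> that contain \<open>us ! i\<close>.\<close>
  let ?J = "{j. Suc j < length us \<and> (j = i \<or> Suc j = i)}"
  have nth_eq: "us ! j = us ! k \<longleftrightarrow> j = k" if "j < length us" "k < length us" for j k
    using that dist by (simp add: nth_eq_iff_index_eq)
  have no_loop: "{e \<in> edges C. e = {us ! i}} = {}"
  proof -
    have "{us ! j, us ! Suc j} \<noteq> {us ! i}" if "Suc j < length us" for j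
      using nth_eq[of j "Suc j"] that by auto
    moreover have "{v, us ! pos v} \<noteq> {us ! i}" if "v \<in> verts C - set us" for v
      using that i by auto
    ultimately show ?thesis unfolding E by blast
  qed
  have inc: "{e \<in> edges C. us ! i \<in> e} =
      (\<lambda>v. {v, us ! i}) ` ?L \<union> (\<lambda>j. {us ! j, us ! Suc j}) ` ?J" (is "_ = ?R")
  proof
    show "{e \<in> edges C. us ! i \<in> e} \<subseteq> ?R"
    proof
      fix e assume "e \<in> {e \<in> edges C. us ! i \<in> e}"
      then consider j where "Suc j < length us" "e = {us ! j, us ! Suc j}" "us ! i \<in> e"
        | v where "v \<in> verts C - set us" "e = {v, us ! pos v}" "us ! i \<in> e"
        unfolding E by blast
      then show "e \<in> ?R"
      proof cases
        case (1 j)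
        then have "j \<in> ?J" using nth_eq[of i j] nth_eq[of i "Suc j"] i by auto
        with 1 show ?thesis by blast
      next
        case (2 v)
        then have "pos v = i" using nth_eq[of i "pos v"] pos[of v] i by auto
        with 2 show ?thesis by auto
      qed
    qed
    show "?R \<subseteq> {e \<in> edges C. us ! i \<in> e}" unfolding E by auto
  qed
  have "card {e \<in> edges C. us ! i \<in> e} =
      card ((\<lambda>v. {v, us ! i}) ` ?L) + card ((\<lambda>j. {us ! j, us ! Suc j}) ` ?J)"
    unfolding inc
  proof (rule card_Un_disjoint)
    show "finite ((\<lambda>j. {us ! j, us ! Suc j}) ` ?J)"
      by (intro finite_imageI finite_subset[of ?J "{..i}"]) auto
    show "(\<lambda>v. {v, us ! i}) ` ?L \<inter> (\<lambda>j. {us ! j, us ! Suc j}) ` ?J = {}"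
    proof -
      have "{v, us ! i} \<noteq> {us ! j, us ! Suc j}" if "v \<in> ?L" "j \<in> ?J" for v j
      proof -
        have "us ! j \<in> set us" "us ! Suc j \<in> set us" "v \<notin> set us"
          using that by auto
        then show ?thesis by (metis insert_iff singletonD)
      qed
      then show ?thesis by blast
    qed
  qed (use fin in auto)
  moreover have "card ((\<lambda>v. {v, us ! i}) ` ?L) = card ?L"
    by (rule card_image) (auto simp: inj_on_def doubleton_eq_iff)
  moreover have "card ((\<lambda>j. {us ! j, us ! Suc j}) ` ?J) = card ?J"
  proof (rule card_image, rule inj_onI)
    fix j k assume jk: "j \<in> ?J" "k \<in> ?J" "{us ! j, us ! Suc j} = {us ! k, us ! Suc k}"
    then have "us ! j = us ! k \<or> us ! j = us ! Suc k \<and> us ! Suc j = us ! k"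
      by (auto simp: doubleton_eq_iff)
    then have "j = k \<or> j = Suc k \<and> Suc j = k"
      using jk(1,2) by (simp add: nth_eq)
    then show "j = k" by auto
  qed
  moreover have "card ?J = (if i = 0 then 0 else 1) + (if Suc i < length us then 1 else 0)"
  proof -
    have J: "?J = (if i = 0 then {} else {i - 1}) \<union> (if Suc i < length us then {i} else {})"
      using i by auto
    show ?thesis unfolding J by auto
  qed
  ultimately show ?thesis
    by (simp add: deg_def no_loop)
qed

section \<open>Deer graphs\<close>

theorem theorem2p5:
  fixes G :: "'a ugraph"
  assumes "deer_graph G"
  shows "super_edge_magic G"
proof -
  from assms obtain C us t where cat: "caterpillar_spine C us" and len: "length us = 2 * t + 1"
    and sym: "\<forall>i\<in>{1..2 * t + 1}. deg C (us ! (i - 1)) = deg C (us ! (2 * t + 1 - i))"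
    and G: "G = add_loop C (us ! t)"
    by (auto simp: deer_graph_def)
  let ?V = "verts C"
  have ne: "us \<noteq> []" using len by auto
  have fin: "finite ?V" and dist: "distinct us" and us: "set us \<subseteq> ?V"
    using cat by (auto simp: caterpillar_spine_def is_tree_def fin_ugraph_def is_path_graph_def
        induced_subgraph_def)
  from caterpillar_positions[OF cat ne] obtain pos where
    pos_us: "\<And>i. i < length us \<Longrightarrow> pos (us ! i) = i" and
    pos_less: "\<And>v. v \<in> ?V \<Longrightarrow> pos v < length us" and
    E: "edges C = (\<lambda>i. {us ! i, us ! Suc i}) ` {i. Suc i < length us} \<union>
       (\<lambda>v. {v, us ! pos v}) ` (?V - set us)"
    by blast
  have us_pos: "us ! pos v = v" if "v \<in> set us" for v
    using that pos_us by (auto simp: in_set_conv_nth)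
  have us_in: "us ! i \<in> set us" "us ! i \<in> ?V" if "i < length us" for i
    using that us by auto

  \<comment> \<open>Leaves at the same spine vertex may come in any order; \<open>h\<close> breaks the ties.\<close>
  obtain h :: "'a \<Rightarrow> nat" where h: "inj_on h ?V"
    using finite_imp_inj_to_nat_seg[OF fin] by auto
  define key where "key v = (pos v, if v \<in> set us then 0 else Suc (h v))" for v
  define par where "par v = us ! (if v \<in> set us then pos v - 1 else pos v)" for v
  \<comment> \<open>The colour of a spine vertex is the parity of its position, and a leaf has the opposite colour;
    \<open>A\<close> is the class that contains \<open>us ! t\<close>.\<close>
  define A where "A = {v \<in> ?V. even (pos v + t) \<longleftrightarrow> v \<in> set us}"

  have spine_edges: "(\<lambda>i. {us ! i, us ! Suc i}) ` {i. Suc i < length us} =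
      (\<lambda>v. {v, par v}) ` (set us - {us ! 0})"
  proof -
    have tl: "set us - {us ! 0} = (\<lambda>i. us ! Suc i) ` {i. Suc i < length us}"
    proof (intro set_eqI iffI)
      fix v assume v: "v \<in> set us - {us ! 0}"
      then obtain i where i: "i < length us" "v = us ! i" by (auto simp: in_set_conv_nth)
      with v obtain j where "i = Suc j" by (cases i) auto
      with i show "v \<in> (\<lambda>i. us ! Suc i) ` {i. Suc i < length us}" by auto
    qed (use dist len in \<open>auto simp: nth_eq_iff_index_eq\<close>)
    have "{us ! Suc i, par (us ! Suc i)} = {us ! i, us ! Suc i}" if "Suc i < length us" for i
      using that by (auto simp: par_def pos_us)
    then show ?thesis
      unfolding tl image_image by (intro image_cong) auto
  qed
  have "(\<lambda>v. {v, us ! pos v}) ` (?V - set us) = (\<lambda>v. {v, par v}) ` (?V - set us)"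
    by (intro image_cong) (auto simp: par_def)
  then have "edges C = (\<lambda>v. {v, par v}) ` ((set us - {us ! 0}) \<union> (?V - set us))"
    unfolding E spine_edges by (simp add: image_Un)
  also have "(set us - {us ! 0}) \<union> (?V - set us) = ?V - {us ! 0}"
    using us us_in[of 0] len by auto
  finally have edges: "edges C = (\<lambda>v. {v, par v}) ` (?V - {us ! 0})" .

  have "super_edge_magic \<lparr>verts = ?V,
      edges = insert {us ! t} ((\<lambda>v. {v, par v}) ` (?V - {us ! 0}))\<rparr>"
  proof (rule zigzag_super_edge_magic[where key = key and A = A])
    show "inj_on key ?V"
    proof (rule inj_onI)
      fix v w assume vw: "v \<in> ?V" "w \<in> ?V" "key v = key w"
      then have "(v \<in> set us \<and> w \<in> set us \<and> pos v = pos w) \<or> h v = h w"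
        by (auto simp: key_def split: if_splits)
      then show "v = w"
        using us_pos h vw(1,2) by (metis inj_onD)
    qed
    show "A \<subseteq> ?V" "us ! 0 \<in> ?V" "us ! t \<in> A"
      using us_in[of 0] us_in[of t] pos_us[of t] len by (auto simp: A_def)
    show "key (us ! 0) \<le> key v" if "v \<in> ?V" for v
      using len us_in[of 0] pos_us[of 0] by (auto simp: key_def)
  next
    fix v assume v: "v \<in> ?V" "v \<noteq> us ! 0"
    have "pos v \<noteq> 0" if "v \<in> set us"
      using us_pos[OF that] v by (metis)
    then have par: "par v \<in> set us"
      "pos (par v) = (if v \<in> set us then pos v - 1 else pos v)" "v \<in> set us \<Longrightarrow> pos v > 0"
      using v pos_less[of v] pos_us us_in by (auto simp: par_def)
    show "par v \<in> ?V" using par us by auto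
    show "key (par v) < key v" using par by (auto simp: key_def)
    show "par v \<in> A \<longleftrightarrow> v \<notin> A" using par v us by (auto simp: A_def)
    fix w assume w: "w \<in> ?V" "key w < key v" "w \<in> A \<longleftrightarrow> v \<notin> A"
    \<comment> \<open>At the position of \<open>par v\<close>, all vertices but \<open>par v\<close> are leaves and share the colour of \<open>v\<close>.\<close>
    have same: "w \<in> set us" if "pos w = pos (par v)"
      using w par v that by (auto simp: A_def split: if_splits)
    have "pos w \<le> pos (par v)"
      using w par by (auto simp: key_def split: if_splits)
    with same par(1) show "key w \<le> key (par v)" by (auto simp: key_def le_less)
  next
    define n where "n i = card {v \<in> A. pos v = i}" for i
    have finA: "finite A" using fin by (simp add: A_def)
    have n: "card {v \<in> A. pos v \<in> I} = sum n I" if "finite I" for I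
    proof -
      have "{v \<in> A. pos v \<in> I} = (\<Union>i\<in>I. {v \<in> A. pos v = i})" by auto
      then show ?thesis
        unfolding n_def using that finA by (auto intro: card_UN_disjoint)
    qed
    have leaves: "card {v \<in> ?V - set us. pos v = 2 * t - i} = card {v \<in> ?V - set us. pos v = i}"
      if i: "i \<le> 2 * t" for i
    proof -
      have "deg C (us ! i) = deg C (us ! (2 * t - i))"
        using sym[rule_format, of "i + 1"] i by simp
      then show ?thesis
        using deg_spine[OF dist us fin E pos_less, of i]
          deg_spine[OF dist us fin E pos_less, of "2 * t - i"] i len
        by (auto split: if_splits)
    qed
    \<comment> \<open>A position contributes to \<open>A\<close> either its spine vertex or its leaves, and mirror positions
      have the same parity.\<close>
    have n_sym: "n (2 * t - i) = n i" if i: "i \<le> 2 * t" for i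
    proof -
      have A_pos: "{v \<in> A. pos v = j} =
          (if even (j + t) then {us ! j} else {v \<in> ?V - set us. pos v = j})"
        if "j \<le> 2 * t" for j
        using that us_pos us_in[of j] pos_us[of j] len by (auto simp: A_def)
      show ?thesis
        unfolding n_def using i leaves[OF i] by (simp add: A_pos)
    qed
    \<comment> \<open>At position \<open>t\<close>, only \<open>us ! t\<close> is in \<open>A\<close>; the comparison of keys on \<open>A\<close> with the key of \<open>us ! t\<close>
      is therefore one of positions.\<close>
    have c: "key (us ! t) = (t, 0)"
      using len us_in[of t] pos_us[of t] by (auto simp: key_def)
    have "{v \<in> A. key v < key (us ! t)} = {v \<in> A. pos v \<in> {..<t}}"
      unfolding c by (auto simp: key_def)
    moreover have "{v \<in> A. key (us ! t) < key v} = {v \<in> A. pos v \<in> {t<..2 * t}}"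
    proof -
      have "(t, 0) < key v \<longleftrightarrow> t < pos v \<and> pos v \<le> 2 * t" if "v \<in> A" for v
        using that pos_less[of v] len by (cases "pos v = t") (auto simp: key_def A_def)
      then show ?thesis unfolding c by auto
    qed
    moreover have "sum n {..<t} = sum n {t<..2 * t}"
      by (rule sum.reindex_bij_witness[where i = "\<lambda>i. 2 * t - i" and j = "\<lambda>i. 2 * t - i"])
        (auto simp: n_sym)
    ultimately show "card {v \<in> A. key v < key (us ! t)} = card {v \<in> A. key (us ! t) < key v}"
      by (simp only: n finite_lessThan finite_greaterThanAtMost)
  qed (use fin in auto)
  then show ?thesis
    by (simp add: G add_loop_def edges)
qed

end
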